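(* Fix a converter $i\in[N]$ and consider the setting described in the context (homogeneous resistive-inductive lines and filters, with equivalent admittance $\tilde{\mathbf Y}_i(\mathbf j\omega)=\tilde\gamma_i/(\rho+\mathbf j(\omega+1))$). Let $\theta_i=(\rho,\tilde\gamma_i)^\top$, let $\hat\theta_i=(\hat\rho,\hat{\tilde\gamma}_i)^\top$ be a parameter estimate, and suppose the error $\epsilon_i^\theta:=\hat\theta_i-\theta_i$ is bounded by $$\lVert\epsilon_i^\theta\rVert<\tilde\gamma_i\,\mathcal S_i\sqrt{\frac{1+\mathrm{Mean}\{|h_i'(\mathbf j\omega_k)|^2\}}{\mathrm{Var}\{\mathrm{Re}\,h_i'(\mathbf j\omega_k)\}+\mathrm{Mean}\{(\mathrm{Im}\,h_i'(\mathbf j\omega_k))^2\}}}.$$ Let $\hat d_i(\omega_k)$ be the Kalman filter estimate of $d_i(\omega_k)$ defined in the context, $\epsilon_i^d(\omega_k):=\hat d_i(\omega_k)-d_i(\omega_k)$, and $\Delta d_i(\omega_k):=d_i(\omega_k)-d_i(\omega_{k-1})$. Then there is a contraction constant $\varphi\in(0,1)$ such that for all $k$ $$\mathbb E[\lVert\epsilon_i^d(\omega_k)\rVert^2]\le\varphi^2\Big(\mathbb E[\lVert\epsilon_i^d(\omega_{k-1})\rVert^2]+\mathbb E[\lVert\Delta d_i(\omega_k)\rVert^2]\Big)+\frac{2\lVert\epsilon_i^\theta\rVert^2}{\hat{\tilde\gamma}_i^2}\Big(1+|h_i(\mathbf j\omega_k)|^2+\mathbb E[\lVert d_i(\omega_k)\rVert^2]\Big).$$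 Moreover, the equivalent voltage estimation error $e_i^v(\mathbf j\omega_k):=\Delta\hat{\tilde{\mathbf v}}_i(\mathbf j\omega_k)-\Delta\tilde{\mathbf v}_i(\mathbf j\omega_k)$ satisfies $$\mathbb E[\lVert e_i^v(\mathbf j\omega_k)\rVert^2]=|\Delta\mathbf v_i(\mathbf j\omega_k)|^2\,\mathbb E[\lVert\epsilon_i^d(\omega_k)\rVert^2],$$ so that it is bounded by $|\Delta\mathbf v_i(\mathbf j\omega_k)|^2$ times the right-hand side of the recursive bound.
   Context: Notation: $[N]=\{1,\dots,N\}$; $\mathbf j$ is the imaginary unit; $s=\mathbf j\omega$; $z^\star$ is the complex conjugate; $\lVert x\rVert$ is the Euclidean norm; $\mathrm{Mean}\{x(k)\}$, $\mathrm{Var}\{x(k)\}$ are the mean and variance of $x(k)$ across the data points $k=0,1,\dots,N_s$; $[x]_p$ is the $p$-th entry of $x$. Frequencies are $\omega_k=2\pi(f_s/N_s)k$, $k=0,\dots,N_s$, with $f_s$ the sampling frequency; $x(k)$ abbreviates $x(\omega_k)$ or $x(\mathbf j\omega_k)$. Network. $N$ converters are interconnected by lines. $\Delta\mathbf v_i,\Delta\mathbf i_i,\Delta\mathbf u_i\in\mathbb C$ denote the small-signal voltage and injected current at the point of common coupling $i$ and the internal voltage of converter $i$ (complex $dq$ coordinates). All lines are resistive-inductive with resistances $r_{ij}$ and inductances $l_{ij}$ (p.u.), homogeneous: $r_{ij}/l_{ij}=\rho\ll1$ for all $i,j$; the filters, with resistances $r_i^f$ and inductances $l_i^f$, are homogeneous: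 $r_i^f/l_i^f=\rho^f\ll1$ for all $i$. Put $\gamma_{im}=1/l_{im}$ and let $\Gamma$ be the Laplacian matrix with off-diagonal entries $-\gamma_{im}$ and diagonal entries $\gamma_{ii}=\sum_{m\ne i}\gamma_{im}$; $\Gamma_{i,-i}$ is row $i$ of $\Gamma$ with entry $i$ removed, $\Gamma_{-i,-i}$ is $\Gamma$ with row and column $i$ removed, $L_{-i}^f=\mathrm{diag}(l_j^f)_{j\ne i}$. The equivalent model seen from $i$ is $$\Delta\mathbf i_i=\tilde{\mathbf Y}_i(\Delta\mathbf v_i-\Delta\tilde{\mathbf v}_i),\quad \tilde{\mathbf Y}_i=\frac{\tilde\gamma_i}{s+\mathbf j+\rho},\quad \tilde\gamma_i=\gamma_{ii}-\Gamma_{i,-i}L_{-i}^f(I_{N-1}+\Gamma_{-i,-i}L_{-i}^f)^{-1}\Gamma_{i,-i}^\top,$$ with equivalent voltage $\Delta\tilde{\mathbf v}_i=-\frac1{\tilde\gamma_i}\Gamma_{i,-i}\big(I_{N-1}-L_{-i}^f(I_{N-1}+\Gamma_{-i,-i}L_{-i}^f)^{-1}\Gamma_{-i,-i}\big)\Delta\mathbf u_{-i}$, where $\Delta\mathbf u_{-i}$ is the vector of the $\Delta\mathbf u_j$, $j\neq i$. Measurement map. Let $h_i=\Delta\mathbf i_i/\Delta\mathbf v_i$ and $\tilde h_i=\Delta\tilde{\mathbf v}_i/\Delta\mathbf v_i$, so $h_i=\tilde{\mathbf Y}_i(1-\tilde h_i)$; equivalently $z_i(k)=H_i(k)\theta_i-[\theta_i]_2d_i(k)$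 with $$z_i(k)=\begin{bmatrix}-(\omega_k+1)\mathrm{Im}\,h_i(\mathbf j\omega_k)\\(\omega_k+1)\mathrm{Re}\,h_i(\mathbf j\omega_k)\end{bmatrix},\quad H_i(k)=\begin{bmatrix}-\mathrm{Re}\,h_i(\mathbf j\omega_k)&1\\-\mathrm{Im}\,h_i(\mathbf j\omega_k)&0\end{bmatrix},\quad d_i(k)=\begin{bmatrix}\mathrm{Re}\,\tilde h_i(\mathbf j\omega_k)\\\mathrm{Im}\,\tilde h_i(\mathbf j\omega_k)\end{bmatrix}.$$ Quantities in the assumed bound on $\epsilon_i^\theta$. $\mathbf r_i$ is the excitation signal injected by converter $i$; $h_i'(\mathbf j\omega_k)=\mathbb E[\mathbf r_i^\star\Delta\mathbf i_i]/\mathbb E[\mathbf r_i^\star\Delta\mathbf v_i]$ evaluated at $\mathbf j\omega_k$; $G_i,\tilde G_i$ are the closed-loop transfer functions from $\mathbf r_i$ to $\Delta\mathbf v_i$ and to $\Delta\tilde{\mathbf v}_i$, respectively; $\mathcal S_i=\sqrt{\mathrm{Mean}\{|\tilde G_i(\mathbf j\omega_k)/G_i(\mathbf j\omega_k)|^2\}}$. Kalman filter. The process model for $d_i$ is the random walk $d_i(k+1)=d_i(k)+q_i(k)$, $q_i(k)\sim\mathcal N(0,Q)$, $Q=\sigma_qI_2$, $\sigma_q>0$. The filter's measurement model is $\tilde z_i(k)=[\hat\theta_i]_2d_i(k)+\nu_i^d(k)$, $\nu_i^d(k)\sim\mathcal N(0,R_d)$, $R_d=c_1I_2$, $c_1>0$,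 where the data fed to the filter are the residuals $\tilde z_i(k)=H_i(k)\hat\theta_i-z_i(k)$. The estimates are $$\hat d_i(k)=\hat d_i(k-1)+K_d(k)\big(\tilde z_i(k)-[\hat\theta_i]_2\hat d_i(k-1)\big),$$ $$K_d(k)=[\hat\theta_i]_2(P_d(k)+Q)\big(R_d+[\hat\theta_i]_2^2(P_d(k)+Q)\big)^{-1},\quad P_d(k+1)=(I_2-[\hat\theta_i]_2K_d(k))(P_d(k)+Q),$$ with $P_d$ positive definite. Here $[\hat\theta_i]_2=\hat{\tilde\gamma}_i$. The equivalent voltage estimate is $\Delta\hat{\tilde{\mathbf v}}_i(\mathbf j\omega_k)=\Delta\mathbf v_i(\mathbf j\omega_k)\big([\hat d_i(\omega_k)]_1+\mathbf j[\hat d_i(\omega_k)]_2\big)$. Expectations are over the randomness of the model; all quotients are assumed well defined.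
   Formalization: Since d_i is a random walk, h_i is random, and the bound with |h_i|² outside the expectation fails; |h_i|² is replaced by E[|h_i|²]. Δv_i and θ̂_i are non-random, the q_i(k) are independent of each other and of (d_i(0), d̂_i(0)), and d_i(0), d̂_i(0) are square integrable. *)

theory Defs
  imports
    "Jordan_Normal_Form.Gauss_Jordan_Elimination"
    "Jordan_Normal_Form.Determinant"
    "HOL-Probability.Probability"
begin

text \<open>
  Matrices indexed by the converters (whose number is a variable) are matrices of the
  Jordan normal form library; two-dimensional vectors and matrices are \<open>real ^ 2\<close> and
  \<open>real ^ 2 ^ 2\<close>. The notation \<open>$\<close> is kept for the latter.
\<close>

no_notation Matrix.vec_index (infixl \<open>$\<close> 100)
no_notation Matrix.scalar_prod (infix \<open>\<bullet>\<close> 70)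


section \<open>Network\<close>

text \<open>
  The \<open>N\<close> converters are numbered \<open>0, \<dots>, N - 1\<close>. The relation \<open>line\<close> says which pairs are
  joined by a line; \<open>\<gamma>\<close> vanishes on the other pairs.
\<close>

definition homogeneous_lines ::
    "nat \<Rightarrow> (nat \<Rightarrow> nat \<Rightarrow> bool) \<Rightarrow> (nat \<Rightarrow> nat \<Rightarrow> real) \<Rightarrow> (nat \<Rightarrow> nat \<Rightarrow> real) \<Rightarrow> real \<Rightarrow> bool" where
  "homogeneous_lines N line r l \<rho> \<longleftrightarrow>
     (\<forall>a<N. \<forall>b<N. line a b \<longrightarrow>
        a \<noteq> b \<and> line b a \<and> l b a = l a b \<and> r b a = r a b \<and>
        l a b > 0 \<and> r a b > 0 \<and> r a b / l a b = \<rho>)"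

definition homogeneous_filters :: "nat \<Rightarrow> (nat \<Rightarrow> real) \<Rightarrow> (nat \<Rightarrow> real) \<Rightarrow> real \<Rightarrow> bool" where
  "homogeneous_filters N rf lf \<rho>f \<longleftrightarrow>
     (\<forall>a<N. lf a > 0 \<and> rf a > 0 \<and> rf a / lf a = \<rho>f)"

definition susceptance :: "(nat \<Rightarrow> nat \<Rightarrow> bool) \<Rightarrow> (nat \<Rightarrow> nat \<Rightarrow> real) \<Rightarrow> nat \<Rightarrow> nat \<Rightarrow> real" where
  "susceptance line l a b = (if line a b then 1 / l a b else 0)"

definition laplacian :: "nat \<Rightarrow> (nat \<Rightarrow> nat \<Rightarrow> bool) \<Rightarrow> (nat \<Rightarrow> nat \<Rightarrow> real) \<Rightarrow> real mat" where
  "laplacian N line l = Matrix.mat N N (\<lambda>(a, b).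
     if a = b then (\<Sum>m\<in>{0..<N} - {a}. susceptance line l a m) else - susceptance line l a b)"

text \<open>
  For \<open>j < N - 1\<close>, \<open>insert_index i j\<close> is the \<open>j\<close>-th element of \<open>{0..<N} - {i}\<close>. So
  \<open>remove_entry N i x\<close> is the vector of the \<open>x j\<close> with \<open>j \<noteq> i\<close>; \<open>mat_delete A i i\<close> is \<open>A\<close>
  with row and column \<open>i\<close> removed.
\<close>

definition remove_entry :: "nat \<Rightarrow> nat \<Rightarrow> (nat \<Rightarrow> 'b) \<Rightarrow> 'b Matrix.vec" where
  "remove_entry N i x = Matrix.vec (N - 1) (\<lambda>j. x (insert_index i j))"

text \<open>
  The matrix \<open>L (I + \<Gamma> L)\<^sup>-\<^sup>1\<close> with \<open>\<Gamma> = \<Gamma>\<^bsub>-i,-i\<^esub>\<close> and \<open>L = L\<^bsub>-i\<^esub>\<close>. The inverse exists because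
  \<open>\<Gamma>\<^bsub>-i,-i\<^esub>\<close> is positive semidefinite and \<open>L\<^bsub>-i\<^esub>\<close> is a positive diagonal matrix.
\<close>

definition elimination_mat :: "nat \<Rightarrow> real mat \<Rightarrow> (nat \<Rightarrow> real) \<Rightarrow> nat \<Rightarrow> real mat" where
  "elimination_mat N \<Gamma> lf i =
     (let L = mat_diag (N - 1) (\<lambda>j. lf (insert_index i j)); \<Gamma>' = mat_delete \<Gamma> i i
      in L * the (mat_inverse (1\<^sub>m (N - 1) + \<Gamma>' * L)))"

definition equiv_susceptance :: "nat \<Rightarrow> real mat \<Rightarrow> (nat \<Rightarrow> real) \<Rightarrow> nat \<Rightarrow> real" where
  "equiv_susceptance N \<Gamma> lf i =
     (let g = remove_entry N i (\<lambda>j. \<Gamma> $$ (i, j))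
      in \<Gamma> $$ (i, i) - Matrix.scalar_prod g (elimination_mat N \<Gamma> lf i *\<^sub>v g))"

definition equiv_voltage ::
    "nat \<Rightarrow> real mat \<Rightarrow> (nat \<Rightarrow> real) \<Rightarrow> nat \<Rightarrow> (nat \<Rightarrow> complex) \<Rightarrow> complex" where
  "equiv_voltage N \<Gamma> lf i u =
     - (1 / complex_of_real (equiv_susceptance N \<Gamma> lf i)) *
       Matrix.scalar_prod (remove_entry N i (\<lambda>j. complex_of_real (\<Gamma> $$ (i, j))))
         (map_mat complex_of_real
            (1\<^sub>m (N - 1) - elimination_mat N \<Gamma> lf i * mat_delete \<Gamma> i i) *\<^sub>v remove_entry N i u)"

definition equiv_admittance :: "real \<Rightarrow> real \<Rightarrow> complex \<Rightarrow> complex" where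
  "equiv_admittance \<gamma> \<rho> s = complex_of_real \<gamma> / (s + \<i> + complex_of_real \<rho>)"


section \<open>Frequencies and data points\<close>

definition freq :: "real \<Rightarrow> nat \<Rightarrow> nat \<Rightarrow> real" where
  "freq fs Ns k = 2 * pi * (fs / real Ns) * real k"

definition jfreq :: "real \<Rightarrow> nat \<Rightarrow> nat \<Rightarrow> complex" where
  "jfreq fs Ns k = \<i> * complex_of_real (freq fs Ns k)"

definition data_mean :: "nat \<Rightarrow> (nat \<Rightarrow> real) \<Rightarrow> real" where
  "data_mean Ns x = (\<Sum>k=0..Ns. x k) / (real Ns + 1)"

definition data_var :: "nat \<Rightarrow> (nat \<Rightarrow> real) \<Rightarrow> real" where
  "data_var Ns x = data_mean Ns (\<lambda>k. (x k - data_mean Ns x)\<^sup>2)"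


section \<open>Measurement map\<close>

definition meas_vec :: "real \<Rightarrow> complex \<Rightarrow> real ^ 2" where
  "meas_vec \<omega> h = vector [- (\<omega> + 1) * Im h, (\<omega> + 1) * Re h]"

definition meas_mat :: "complex \<Rightarrow> real ^ 2 ^ 2" where
  "meas_mat h = vector [vector [- Re h, 1], vector [- Im h, 0]]"

definition re_im :: "complex \<Rightarrow> real ^ 2" where
  "re_im c = vector [Re c, Im c]"


section \<open>Excitation\<close>

text \<open>
  \<open>G\<close> is the transfer function from the excitation \<open>r\<close> to the signal \<open>y\<close>: by linearity, \<open>y\<close> is
  \<open>G r\<close> plus the response to the other inputs of the closed loop, which are uncorrelated
  with \<open>r\<close>.
\<close>

definition transfer_function ::
    "'a measure \<Rightarrow> (nat \<Rightarrow> complex) \<Rightarrow> nat \<Rightarrow> (nat \<Rightarrow> 'a \<Rightarrow> complex) \<Rightarrow> (nat \<Rightarrow> 'a \<Rightarrow> complex) \<Rightarrow>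
     (complex \<Rightarrow> complex) \<Rightarrow> bool" where
  "transfer_function M s Ns r y G \<longleftrightarrow>
     (\<exists>n. \<forall>k\<le>Ns. (\<forall>x\<in>space M. y k x = G (s k) * r k x + n k x) \<and>
        has_bochner_integral M (\<lambda>x. cnj (r k x) * n k x) 0)"

definition ratio_estimate ::
    "'a measure \<Rightarrow> (nat \<Rightarrow> 'a \<Rightarrow> complex) \<Rightarrow> (nat \<Rightarrow> 'a \<Rightarrow> complex) \<Rightarrow> (nat \<Rightarrow> 'a \<Rightarrow> complex) \<Rightarrow>
     nat \<Rightarrow> complex" where
  "ratio_estimate M r cur volt k =
     (LINT x|M. cnj (r k x) * cur k x) / (LINT x|M. cnj (r k x) * volt k x)"


section \<open>Random walk and Kalman filter\<close>

definition posdef :: "real ^ 'n ^ 'n \<Rightarrow> bool" where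
  "posdef A \<longleftrightarrow> transpose A = A \<and> (\<forall>x. x \<noteq> 0 \<longrightarrow> x \<bullet> (A *v x) > 0)"

definition gaussian_density :: "real ^ 'n \<Rightarrow> real ^ 'n ^ 'n \<Rightarrow> real ^ 'n \<Rightarrow> real" where
  "gaussian_density \<mu> \<Sigma> x =
     exp (- ((x - \<mu>) \<bullet> (matrix_inv \<Sigma> *v (x - \<mu>))) / 2) / sqrt ((2 * pi) ^ CARD('n) * det \<Sigma>)"

text \<open>
  \<open>d0\<close> is the initial value of the filter. The increments are independent of each other and
  of the initial pair \<open>(d 0, d0)\<close>. All members of an independent family have
  the same type, hence the padding of the increments with \<open>0\<close>.
\<close>

definition random_walk ::
    "'a measure \<Rightarrow> nat \<Rightarrow> real ^ 2 ^ 2 \<Rightarrow> ('a \<Rightarrow> real ^ 2) \<Rightarrow> (nat \<Rightarrow> 'a \<Rightarrow> real ^ 2) \<Rightarrow>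
     (nat \<Rightarrow> 'a \<Rightarrow> real ^ 2) \<Rightarrow> bool" where
  "random_walk M Ns Q d0 d q \<longleftrightarrow>
     (\<forall>k<Ns. \<forall>x\<in>space M. d (Suc k) x = d k x + q k x) \<and>
     (\<forall>k<Ns. distributed M lborel (q k) (\<lambda>y. ennreal (gaussian_density 0 Q y))) \<and>
     prob_space.indep_vars M (\<lambda>_. borel)
       (case_nat (\<lambda>x. (d 0 x, d0 x)) (\<lambda>k x. (q k x, 0))) {0..Ns}"

definition kalman_gain :: "real \<Rightarrow> real ^ 2 ^ 2 \<Rightarrow> real ^ 2 ^ 2 \<Rightarrow> real ^ 2 ^ 2 \<Rightarrow> real ^ 2 ^ 2" where
  "kalman_gain g Q R P = g *\<^sub>R ((P + Q) ** matrix_inv (R + g\<^sup>2 *\<^sub>R (P + Q)))"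

text \<open>The data points \<open>1, \<dots>, Ns\<close> are processed, starting from an arbitrary \<open>dhat 0\<close>.\<close>

definition kalman_filter ::
    "'a measure \<Rightarrow> nat \<Rightarrow> real \<Rightarrow> real ^ 2 ^ 2 \<Rightarrow> real ^ 2 ^ 2 \<Rightarrow> (nat \<Rightarrow> 'a \<Rightarrow> real ^ 2) \<Rightarrow>
     (nat \<Rightarrow> real ^ 2 ^ 2) \<Rightarrow> (nat \<Rightarrow> 'a \<Rightarrow> real ^ 2) \<Rightarrow> bool" where
  "kalman_filter M Ns g Q R zt P dhat \<longleftrightarrow>
     (\<forall>k\<in>{1..Ns}. posdef (P k)) \<and>
     (\<forall>k\<in>{1..<Ns}. P (k + 1) =
        (Finite_Cartesian_Product.mat 1 - g *\<^sub>R kalman_gain g Q R (P k)) ** (P k + Q)) \<and>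
     (\<forall>k\<in>{1..Ns}. \<forall>x\<in>space M. dhat k x =
        dhat (k - 1) x + kalman_gain g Q R (P k) *v (zt k x - g *\<^sub>R dhat (k - 1) x))"

end

theory Submission
  imports Defs
begin

text \<open>
  Put \<open>A = I - g K\<close> for the gain \<open>K\<close> at step \<open>k\<close> and \<open>g = [\<theta>hat]\<^sub>2\<close>. The error of the filter is
  \<open>A w + (I - A) y\<close>, where \<open>w\<close> is the previous error minus the increment \<open>\<Delta>d\<close>, and \<open>y\<close> is the
  deviation of the residual from \<open>g d\<close>, divided by \<open>g\<close>. As \<open>A = c\<^sub>1 (c\<^sub>1 I + g\<^sup>2 (P + Q))\<^sup>-\<^sup>1\<close> is
  symmetric with spectrum in \<open>[0, a]\<close> for \<open>a = c\<^sub>1 / (c\<^sub>1 + g\<^sup>2 \<sigma>\<^sub>q)\<close>, convexity of the squared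
  norm bounds that of the error by \<open>a \<parallel>w\<parallel>\<^sup>2 + \<parallel>y\<parallel>\<^sup>2\<close>, so \<open>\<phi>\<^sup>2 = a\<close> works for all \<open>k\<close>. The cross
  term in \<open>\<parallel>w\<parallel>\<^sup>2\<close> has mean \<open>0\<close> because \<open>\<Delta>d\<close> is centred and independent of the previous error,
  and \<open>g y\<close> is linear in the parameter error.
\<close>

section \<open>The Kalman update as a contraction\<close>

lemma norm_complementary_combination:
  fixes f :: "'b::real_inner \<Rightarrow> 'b"
  assumes f: "linear f" and sym: "\<And>x y. f x \<bullet> y = x \<bullet> f y"
    and lower: "\<And>x. (norm (f x))\<^sup>2 \<le> x \<bullet> f x"
    and upper: "\<And>x. x \<bullet> f x \<le> a * (norm x)\<^sup>2"
  shows "(norm (f w + (y - f y)))\<^sup>2 \<le> a * (norm w)\<^sup>2 + (norm y)\<^sup>2"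
proof -
  define u where "u = w - y"
  have w: "w = u + y" by (simp add: u_def)
  have fw: "f w = f u + f y" unfolding w by (rule linear_add[OF f])
  have nonneg: "0 \<le> y \<bullet> f y"
    using lower[of y] by (meson order_trans zero_le_power2)
  have cross: "u \<bullet> f y = y \<bullet> f u" by (metis sym inner_commute)
  have "(norm (f w + (y - f y)))\<^sup>2 = (norm (f u))\<^sup>2 + 2 * (y \<bullet> f u) + (norm y)\<^sup>2"
    by (simp add: fw power2_norm_eq_inner inner_simps inner_commute)
  also have "\<dots> \<le> w \<bullet> f w + (norm y)\<^sup>2"
    using lower[of u] nonneg cross unfolding fw by (simp add: w inner_simps)
  finally show ?thesis using upper[of w] by linarith
qed

lemma mat_mult_vec_scaleR: "Finite_Cartesian_Product.mat c *v x = c *\<^sub>R (x :: real ^ 'n)"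
  by (simp add: vec_eq_iff matrix_vector_mult_def Finite_Cartesian_Product.mat_def
        if_distrib[of "\<lambda>c. c * _"] cong: if_cong)

lemma invertible_matrix_inv:
  assumes "invertible A"
  shows "A ** matrix_inv A = Finite_Cartesian_Product.mat 1"
    and "matrix_inv A ** A = Finite_Cartesian_Product.mat 1"
  using someI_ex[OF assms[unfolded invertible_def]] by (auto simp: matrix_inv_def)

lemma posdef_symmetric: "posdef A \<Longrightarrow> (A *v x) \<bullet> y = x \<bullet> (A *v y)"
  unfolding posdef_def by (metis dot_lmul_matrix vector_transpose_matrix)

lemma kalman_update_contraction:
  fixes P :: "real ^ 2 ^ 2"
  assumes P: "posdef P" and \<sigma>: "\<sigma> > 0" and c: "c > 0" and g: "g \<noteq> 0"
  defines "K \<equiv> kalman_gain g (Finite_Cartesian_Product.mat \<sigma>) (Finite_Cartesian_Product.mat c) P"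
  shows "(norm (w - g *\<^sub>R (K *v w) + K *v y))\<^sup>2 \<le> c / (c + g\<^sup>2 * \<sigma>) * (norm w)\<^sup>2 + (norm y)\<^sup>2 / g\<^sup>2"
proof -
  define S where "S = P + Finite_Cartesian_Product.mat \<sigma>"
  define T where "T = Finite_Cartesian_Product.mat c + g\<^sup>2 *\<^sub>R S"
  define \<tau> where "\<tau> = c + g\<^sup>2 * \<sigma>"
  define f where "f z = c *\<^sub>R (matrix_inv T *v z)" for z
  have \<tau>: "\<tau> > 0" unfolding \<tau>_def using \<sigma> c by (intro add_pos_nonneg) auto
  have S: "S *v x = P *v x + \<sigma> *\<^sub>R x" for x
    by (simp add: S_def matrix_vector_mult_add_rdistrib mat_mult_vec_scaleR)
  have T: "T *v x = c *\<^sub>R x + g\<^sup>2 *\<^sub>R (S *v x)" for x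
    by (simp add: T_def matrix_vector_mult_add_rdistrib mat_mult_vec_scaleR
        scaleR_matrix_vector_assoc)
  have Ppos: "0 \<le> x \<bullet> (P *v x)" for x
    using P unfolding posdef_def by (cases "x = 0") (auto intro: less_imp_le)
  have Spos: "\<sigma> * (norm x)\<^sup>2 \<le> x \<bullet> (S *v x)" for x
    using Ppos[of x] by (simp add: S inner_simps power2_norm_eq_inner)
  have Tsym: "(T *v x) \<bullet> y = x \<bullet> (T *v y)" for x y
    by (simp add: T S inner_simps posdef_symmetric[OF P])
  have Tpos: "\<tau> * (norm x)\<^sup>2 \<le> x \<bullet> (T *v x)" for x
    using mult_left_mono[OF Spos[of x], of "g\<^sup>2"]
    by (simp add: T \<tau>_def inner_simps power2_norm_eq_inner algebra_simps)
  have "x = 0" if "T *v x = 0" for x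
    using Tpos[of x] \<tau> that by (simp add: mult_le_0_iff)
  then have "invertible T"
    using matrix_left_invertible_ker[of T] invertible_left_inverse[of T] by blast
  then have inv: "T *v (matrix_inv T *v z) = z" for z
    by (metis invertible_matrix_inv(1) matrix_vector_mul_assoc matrix_vector_mul_lid)
  have gK: "g *\<^sub>R (K *v z) = z - f z" for z
  proof -
    have "g *\<^sub>R (K *v z) = g\<^sup>2 *\<^sub>R (S *v (matrix_inv T *v z))"
      unfolding K_def kalman_gain_def S_def[symmetric] T_def[symmetric]
      by (simp add: scaleR_matrix_vector_assoc[symmetric] matrix_vector_mul_assoc power2_eq_square)
    then show ?thesis
      using inv[of z] T[of "matrix_inv T *v z"] by (simp add: f_def algebra_simps)
  qed
  have "(norm (f w + ((1 / g) *\<^sub>R y - f ((1 / g) *\<^sub>R y))))\<^sup>2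
      \<le> c / \<tau> * (norm w)\<^sup>2 + (norm ((1 / g) *\<^sub>R y))\<^sup>2"
  proof (rule norm_complementary_combination)
    show "linear f"
      unfolding f_def by (intro linear_compose_scale_right) simp
    fix x y :: "real ^ 2"
    define x' y' where "x' = matrix_inv T *v x" and "y' = matrix_inv T *v y"
    have x: "x = T *v x'" and y: "y = T *v y'" by (simp_all add: x'_def y'_def inv)
    have f: "f x = c *\<^sub>R x'" "f y = c *\<^sub>R y'" by (simp_all add: f_def x'_def y'_def)
    show "f x \<bullet> y = x \<bullet> f y"
      unfolding f by (simp add: x y Tsym)
    have "0 \<le> c * g\<^sup>2 * (x' \<bullet> (S *v x'))"
      using Spos[of x'] \<sigma> c by (meson less_imp_le mult_nonneg_nonneg order_trans zero_le_power2)
    then show "(norm (f x))\<^sup>2 \<le> x \<bullet> f x"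
      unfolding f using c
      by (simp add: x T inner_simps dot_square_norm power_mult_distrib inner_commute
          power2_eq_square algebra_simps)
    have T': "\<tau> * (norm x')\<^sup>2 \<le> norm x' * norm x"
      using Tpos[of x'] norm_cauchy_schwarz[of x' x] unfolding x by linarith
    then have "\<tau> * norm x' \<le> norm x"
      by (cases "x' = 0") (auto simp: power2_eq_square)
    then have "norm x * (\<tau> * norm x') \<le> (norm x)\<^sup>2"
      unfolding power2_eq_square by (intro mult_left_mono) auto
    then have "\<tau> * (x \<bullet> x') \<le> (norm x)\<^sup>2"
      using mult_left_mono[OF norm_cauchy_schwarz[of x x'] less_imp_le[OF \<tau>]]
      by (simp only: mult.left_commute[of \<tau>])
    then have "c * (\<tau> * (x \<bullet> x')) \<le> c * (norm x)\<^sup>2"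
      using c by simp
    then show "x \<bullet> f x \<le> c / \<tau> * (norm x)\<^sup>2"
      unfolding f using \<tau> by (simp add: field_simps)
  qed
  also have "f w + ((1 / g) *\<^sub>R y - f ((1 / g) *\<^sub>R y)) = w - g *\<^sub>R (K *v w) + K *v y"
    using gK[of w] gK[of "(1 / g) *\<^sub>R y"] g
    by (simp add: matrix_vector_mult_scaleR algebra_simps)
  finally show ?thesis
    using g by (simp add: \<tau>_def power_divide)
qed

section \<open>Square-integrable random vectors\<close>

definition square_integrable :: "'a measure \<Rightarrow> ('a \<Rightarrow> 'b::euclidean_space) \<Rightarrow> bool" where
  "square_integrable M f \<longleftrightarrow> f \<in> borel_measurable M \<and> integrable M (\<lambda>x. (norm (f x))\<^sup>2)"

lemma square_integrable_bounded_linear: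
  assumes L: "bounded_linear L" and f: "square_integrable M f"
  shows "square_integrable M (\<lambda>x. L (f x))"
proof -
  obtain B where B: "\<And>y. norm (L y) \<le> norm y * B"
    using bounded_linear.bounded[OF L] by blast
  have [measurable]: "f \<in> borel_measurable M"
    using f by (simp add: square_integrable_def)
  have meas [measurable]: "(\<lambda>x. L (f x)) \<in> borel_measurable M"
    using borel_measurable_continuous_onI[OF linear_continuous_on[OF L]] by measurable
  have "integrable M (\<lambda>x. (norm (L (f x)))\<^sup>2)"
  proof (rule Bochner_Integration.integrable_bound)
    show "integrable M (\<lambda>x. B\<^sup>2 * (norm (f x))\<^sup>2)"
      using f by (simp add: square_integrable_def)
    have "(norm (L y))\<^sup>2 \<le> B\<^sup>2 * (norm y)\<^sup>2" for y
      using power_mono[OF B[of y], of 2] by (simp add: power_mult_distrib mult.commute)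
    then show "AE x in M. norm ((norm (L (f x)))\<^sup>2) \<le> norm (B\<^sup>2 * (norm (f x))\<^sup>2)"
      by simp
  qed measurable
  with meas show ?thesis by (simp add: square_integrable_def)
qed

lemma square_integrable_add:
  assumes f: "square_integrable M f" and g: "square_integrable M g"
  shows "square_integrable M (\<lambda>x. f x + g x)"
proof -
  have [measurable]: "f \<in> borel_measurable M" "g \<in> borel_measurable M"
    using f g by (simp_all add: square_integrable_def)
  have "integrable M (\<lambda>x. (norm (f x + g x))\<^sup>2)"
  proof (rule Bochner_Integration.integrable_bound)
    show "integrable M (\<lambda>x. 2 * (norm (f x))\<^sup>2 + 2 * (norm (g x))\<^sup>2)"
      using f g by (simp add: square_integrable_def)
    have "(norm (a + b))\<^sup>2 \<le> 2 * (norm a)\<^sup>2 + 2 * (norm b)\<^sup>2" for a b :: 'b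
      using inner_ge_zero[of "a - b"] by (simp add: power2_norm_eq_inner inner_simps inner_commute)
    then show "AE x in M. norm ((norm (f x + g x))\<^sup>2) \<le> norm (2 * (norm (f x))\<^sup>2 + 2 * (norm (g x))\<^sup>2)"
      by simp
  qed measurable
  then show ?thesis by (simp add: square_integrable_def)
qed

lemma square_integrable_diff:
  assumes "square_integrable M f" "square_integrable M g"
  shows "square_integrable M (\<lambda>x. f x - g x)"
  using square_integrable_add[OF assms(1)
      square_integrable_bounded_linear[OF bounded_linear_minus[OF bounded_linear_ident] assms(2)]]
  by simp

lemma (in finite_measure) square_integrable_const: "square_integrable M (\<lambda>_. c)"
  by (simp add: square_integrable_def)

lemma (in finite_measure) integrable_square_integrable:
  assumes f: "square_integrable M f"
  shows "integrable M f"
proof (rule Bochner_Integration.integrable_bound)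
  show "integrable M (\<lambda>x. 1 + (norm (f x))\<^sup>2)" and "f \<in> borel_measurable M"
    using f by (simp_all add: square_integrable_def)
  have "norm y \<le> 1 + (norm y)\<^sup>2" for y :: 'b
    using zero_le_power2[of "norm y - 1"] norm_ge_zero[of y] unfolding power2_diff by (simp del: norm_ge_zero)
  then show "AE x in M. norm (f x) \<le> norm (1 + (norm (f x))\<^sup>2)"
    by simp
qed

lemma integrable_inner_square_integrable:
  assumes f: "square_integrable M f" and g: "square_integrable M g"
  shows "integrable M (\<lambda>x. f x \<bullet> g x)"
proof -
  have "(\<lambda>x. f x \<bullet> g x) =
      (\<lambda>x. ((norm (f x + g x))\<^sup>2 - (norm (f x))\<^sup>2 - (norm (g x))\<^sup>2) / 2)"
    by (simp add: fun_eq_iff power2_norm_eq_inner inner_simps inner_commute)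
  then show ?thesis
    using f g square_integrable_add[OF f g]
    by (auto simp: square_integrable_def simp del: divide_cancel_right)
qed

lemma (in prob_space) indep_var_integral_inner:
  fixes X Y :: "'a \<Rightarrow> 'b::euclidean_space"
  assumes indep: "indep_var borel X borel Y" and X: "integrable M X" and Y: "integrable M Y"
  shows "(LINT x|M. X x \<bullet> Y x) = (LINT x|M. X x) \<bullet> (LINT x|M. Y x)"
proof -
  have ind: "indep_var borel (\<lambda>x. X x \<bullet> b) borel (\<lambda>x. Y x \<bullet> b)" for b
    using indep_var_compose[OF indep, of "\<lambda>x. x \<bullet> b" borel "\<lambda>x. x \<bullet> b" borel]
    by (simp add: comp_def)
  have int: "integrable M (\<lambda>x. (X x \<bullet> b) * (Y x \<bullet> b))" for b
    using X Y by (intro indep_var_integrable[OF ind]) auto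
  have "(LINT x|M. X x \<bullet> Y x) = (\<Sum>b\<in>Basis. LINT x|M. (X x \<bullet> b) * (Y x \<bullet> b))"
    by (subst euclidean_inner) (simp add: int)
  also have "\<dots> = (\<Sum>b\<in>Basis. ((LINT x|M. X x) \<bullet> b) * ((LINT x|M. Y x) \<bullet> b))"
    using X Y by (intro sum.cong refl, subst indep_var_lebesgue_integral[OF ind]) auto
  finally show ?thesis by (simp only: euclidean_inner[symmetric])
qed

lemma square_integrable_cong:
  assumes "\<And>x. x \<in> space M \<Longrightarrow> f x = g x"
  shows "square_integrable M f \<longleftrightarrow> square_integrable M g"
  unfolding square_integrable_def
  using assms measurable_cong[of M f g borel] by (auto cong: Bochner_Integration.integrable_cong)

section \<open>Gaussian vectors\<close>

lemma gaussian_density_scalar_covariance: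
  fixes x :: "real ^ 'n"
  assumes "\<sigma> > 0"
  shows "gaussian_density 0 (Finite_Cartesian_Product.mat \<sigma>) x =
    exp (- (norm x)\<^sup>2 / (2 * \<sigma>)) / sqrt ((2 * pi * \<sigma>) ^ CARD('n))"
proof -
  have inv: "matrix_inv (Finite_Cartesian_Product.mat \<sigma> :: real ^ 'n ^ 'n)
      = Finite_Cartesian_Product.mat (1 / \<sigma>)"
  proof -
    have *: "(Finite_Cartesian_Product.mat \<sigma> :: real ^ 'n ^ 'n) ** Finite_Cartesian_Product.mat (1 / \<sigma>)
        = Finite_Cartesian_Product.mat 1"
      and "(Finite_Cartesian_Product.mat (1 / \<sigma>) :: real ^ 'n ^ 'n) ** Finite_Cartesian_Product.mat \<sigma>
        = Finite_Cartesian_Product.mat 1"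
      using assms
      by (simp_all add: matrix_eq matrix_vector_mul_assoc[symmetric] mat_mult_vec_scaleR)
    then have "invertible (Finite_Cartesian_Product.mat \<sigma> :: real ^ 'n ^ 'n)"
      unfolding invertible_def by blast
    from invertible_matrix_inv(2)[OF this] show ?thesis
      by (metis * matrix_mul_assoc matrix_mul_lid matrix_mul_rid)
  qed
  have det: "det (Finite_Cartesian_Product.mat \<sigma> :: real ^ 'n ^ 'n) = \<sigma> ^ CARD('n)"
    by (subst det_diagonal) (auto simp: Finite_Cartesian_Product.mat_def)
  show ?thesis
    unfolding gaussian_density_def inv det
    by (simp add: mat_mult_vec_scaleR power2_norm_eq_inner power_mult_distrib)
qed

lemma integrable_exp_neg_norm_square:
  fixes \<alpha> :: real
  assumes "\<alpha> > 0"
  shows "integrable lborel (\<lambda>x :: 'b::euclidean_space. exp (- \<alpha> * (norm x)\<^sup>2))"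
proof -
  define s where "s = sqrt (1 / (2 * \<alpha>))"
  have s: "s > 0" "s\<^sup>2 = 1 / (2 * \<alpha>)" using assms by (auto simp: s_def)
  have "(\<lambda>t. exp (- \<alpha> * t\<^sup>2)) = (\<lambda>t. sqrt (2 * pi * s\<^sup>2) * normal_density 0 s t)"
    using assms by (simp add: normal_density_def s(2) fun_eq_iff mult.commute)
  then have "integrable lborel (\<lambda>t :: real. exp (- \<alpha> * t\<^sup>2))"
    using s(1) by (simp add: integrable_normal_density)
  then have fin: "(\<integral>\<^sup>+t. ennreal (exp (- \<alpha> * t\<^sup>2)) \<partial>lborel) < \<infinity>"
    by (simp add: integrable_iff_bounded)
  have norm_sum: "(norm x)\<^sup>2 = (\<Sum>b\<in>Basis. (x \<bullet> b)\<^sup>2)" for x :: 'b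
    by (subst power2_norm_eq_inner, subst euclidean_inner) (simp add: power2_eq_square)
  have eq: "exp (- \<alpha> * (norm x)\<^sup>2) = (\<Prod>b\<in>Basis. exp (- \<alpha> * (x \<bullet> b)\<^sup>2))" for x :: 'b
    by (simp add: norm_sum exp_sum[symmetric] sum_distrib_left sum_negf)
  have "(\<integral>\<^sup>+x. ennreal (exp (- \<alpha> * (norm (x :: 'b))\<^sup>2)) \<partial>lborel)
      = (\<Prod>b\<in>(Basis :: 'b set). \<integral>\<^sup>+t. ennreal (exp (- \<alpha> * t\<^sup>2)) \<partial>lborel)"
    unfolding eq by (subst nn_integral_lborel_prod[symmetric]) (simp_all add: prod_ennreal)
  also have "\<dots> < \<infinity>" 
    using fin by (simp add: power_less_top_ennreal)
  finally show ?thesis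
    by (simp add: integrable_iff_bounded)
qed

lemma lborel_uminus: "distr lborel borel uminus = (lborel :: 'b::euclidean_space measure)"
proof -
  have "density (distr lborel borel uminus) (\<lambda>_. 1) = (lborel :: 'b measure)"
    using lborel_affine[of "-1" "0 :: 'b", symmetric] by simp
  then show ?thesis by (simp add: density_1)
qed

lemma gaussian_square_integrable:
  fixes X :: "'a \<Rightarrow> real ^ 'n"
  assumes \<sigma>: "\<sigma> > 0"
    and X: "distributed M lborel X (\<lambda>y. ennreal (gaussian_density 0 (Finite_Cartesian_Product.mat \<sigma>) y))"
  shows "square_integrable M X"
proof -
  let ?f = "gaussian_density 0 (Finite_Cartesian_Product.mat \<sigma> :: real ^ 'n ^ 'n)"
  let ?Z = "sqrt ((2 * pi * \<sigma>) ^ CARD('n))"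
  note dens = gaussian_density_scalar_covariance[OF \<sigma>]
  have Z: "?Z > 0" using \<sigma> by simp
  have [measurable]: "?f \<in> borel_measurable borel"
    unfolding dens by measurable
  have f_nonneg: "0 \<le> ?f y" for y
    using Z by (simp add: dens)
  have "integrable lborel (\<lambda>y. ?f y * (norm y)\<^sup>2)"
  proof (rule Bochner_Integration.integrable_bound)
    show "integrable lborel (\<lambda>y :: real ^ 'n. 4 * \<sigma> / ?Z * exp (- (1 / (4 * \<sigma>)) * (norm y)\<^sup>2))"
      using \<sigma> by (intro integrable_mult_right integrable_exp_neg_norm_square) simp
    have "?f y * (norm y)\<^sup>2 \<le> 4 * \<sigma> / ?Z * exp (- (1 / (4 * \<sigma>)) * (norm y)\<^sup>2)" for y
    proof -
      define t where "t = (norm y)\<^sup>2 / (4 * \<sigma>)"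
      have t: "(norm y)\<^sup>2 = 4 * \<sigma> * t" using \<sigma> by (simp add: t_def)
      have "t \<le> exp t" using exp_ge_add_one_self[of t] by linarith
      then have "exp (- (2 * t)) * t \<le> exp (- (2 * t)) * exp t" by (intro mult_left_mono) auto
      also have "\<dots> = exp (- t)" by (simp add: exp_add[symmetric])
      finally have "4 * \<sigma> / ?Z * (exp (- (2 * t)) * t) \<le> 4 * \<sigma> / ?Z * exp (- t)"
        using \<sigma> Z by (intro mult_left_mono) auto
      then show ?thesis using \<sigma> by (simp add: dens t mult_ac)
    qed
    then show "AE y in lborel. norm (?f y * (norm y)\<^sup>2)
        \<le> norm (4 * \<sigma> / ?Z * exp (- (1 / (4 * \<sigma>)) * (norm y)\<^sup>2))"
      using f_nonneg \<sigma> Z by (simp add: abs_mult)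
  qed measurable
  then have "integrable M (\<lambda>x. (norm (X x))\<^sup>2)"
    using f_nonneg by (subst distributed_integrable[OF X, symmetric]) auto
  moreover have "X \<in> borel_measurable M"
    using distributed_measurable[OF X] by simp
  ultimately show ?thesis by (simp add: square_integrable_def)
qed

lemma gaussian_integral_zero:
  fixes X :: "'a \<Rightarrow> real ^ 'n"
  assumes \<sigma>: "\<sigma> > 0"
    and X: "distributed M lborel X (\<lambda>y. ennreal (gaussian_density 0 (Finite_Cartesian_Product.mat \<sigma>) y))"
  shows "(LINT x|M. X x) = 0"
proof -
  let ?f = "gaussian_density 0 (Finite_Cartesian_Product.mat \<sigma> :: real ^ 'n ^ 'n)"
  note dens = gaussian_density_scalar_covariance[OF \<sigma>]
  have [measurable]: "?f \<in> borel_measurable borel"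
    unfolding dens by measurable
  have f_nonneg: "0 \<le> ?f y" for y
    using \<sigma> by (simp add: dens)
  have even: "?f (- y) = ?f y" for y
    by (simp add: dens)
  have [measurable]: "X \<in> borel_measurable M"
    using distributed_measurable[OF X] by simp
  have "(LINT x|M. X x) = (LINT y|distr M lborel X. y)"
    by (subst integral_distr) auto
  also have "\<dots> = (LINT y|lborel. ?f y *\<^sub>R y)"
    unfolding distributed_distr_eq_density[OF X] using f_nonneg by (subst integral_density) auto
  finally have EX: "(LINT x|M. X x) = (LINT y|lborel. ?f y *\<^sub>R y)" .
  also have "\<dots> = (LINT y|distr lborel borel uminus. ?f y *\<^sub>R y)"
    by (simp add: lborel_uminus)
  also have "\<dots> = (LINT y|lborel. - (?f y *\<^sub>R y))"
    by (subst integral_distr) (auto simp: even)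
  also have "\<dots> = - (LINT x|M. X x)"
    by (simp add: EX)
  finally show ?thesis by (simp add: eq_neg_iff_add_eq_0 scaleR_2[symmetric])
qed

section \<open>Mean square error of the filter\<close>

lemma random_walk_square_integrable:
  assumes \<sigma>: "\<sigma> > 0" and walk: "random_walk M Ns (Finite_Cartesian_Product.mat \<sigma>) d0 d q"
    and d: "square_integrable M (d 0)"
  shows "k \<le> Ns \<Longrightarrow> square_integrable M (d k)"
proof (induction k)
  case (Suc k)
  then have "square_integrable M (d k)" and "square_integrable M (q k)"
    using walk by (auto simp: random_walk_def intro: gaussian_square_integrable[OF \<sigma>])
  then have "square_integrable M (\<lambda>x. d k x + q k x)"
    by (rule square_integrable_add)
  then show ?case
    using walk Suc.prems by (subst square_integrable_cong) (auto simp: random_walk_def)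
qed (use d in simp)

text \<open>
  The filter state at step \<open>n\<close> uses only the first \<open>n\<close> increments, so it is independent of
  the next one.
\<close>

lemma kalman_filter_adapted:
  assumes walk: "random_walk M Ns Q d0 d q" and d0: "d0 = dhat 0"
    and filter: "kalman_filter M Ns g Q R zt P dhat"
    and zt: "\<And>k x. k \<in> {1..Ns} \<Longrightarrow> x \<in> space M \<Longrightarrow> zt k x = Z k (d k x)"
    and Z: "\<And>k. k \<in> {1..Ns} \<Longrightarrow> Z k \<in> borel_measurable borel"
  defines "Y \<equiv> case_nat (\<lambda>x. (d 0 x, d0 x)) (\<lambda>k x. (q k x, 0))"
  shows "n \<le> Ns \<Longrightarrow> \<exists>F E. F \<in> borel_measurable (Pi\<^sub>M {0..n} (\<lambda>_. borel)) \<and>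
    E \<in> borel_measurable (Pi\<^sub>M {0..n} (\<lambda>_. borel)) \<and>
    (\<forall>x\<in>space M. d n x = F (\<lambda>j\<in>{0..n}. Y j x) \<and> dhat n x = E (\<lambda>j\<in>{0..n}. Y j x))"
proof (induction n)
  case 0
  have comp: "(\<lambda>f. f 0) \<in> measurable (Pi\<^sub>M {0..0::nat} (\<lambda>_. borel)) (borel :: ((real ^ 2) \<times> (real ^ 2)) measure)"
    by (rule measurable_component_singleton) simp
  have fs: "fst \<in> borel_measurable (borel :: ((real ^ 2) \<times> (real ^ 2)) measure)"
    "snd \<in> borel_measurable (borel :: ((real ^ 2) \<times> (real ^ 2)) measure)"
    by (auto intro!: borel_measurable_continuous_onI continuous_intros)
  show ?case
    using measurable_compose[OF comp fs(1)] measurable_compose[OF comp fs(2)]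
    by (intro exI[of _ "\<lambda>f. fst (f 0)"] exI[of _ "\<lambda>f. snd (f 0)"]) (simp add: Y_def d0)
next
  case (Suc n)
  from Suc.IH[OF Suc_leD[OF Suc.prems]]
  obtain F E where F: "F \<in> borel_measurable (Pi\<^sub>M {0..n} (\<lambda>_. borel))"
    and E: "E \<in> borel_measurable (Pi\<^sub>M {0..n} (\<lambda>_. borel))"
    and FE: "\<And>x. x \<in> space M \<Longrightarrow> d n x = F (\<lambda>j\<in>{0..n}. Y j x)"
      "\<And>x. x \<in> space M \<Longrightarrow> dhat n x = E (\<lambda>j\<in>{0..n}. Y j x)"
    by blast
  let ?B = "Pi\<^sub>M {0..Suc n} (\<lambda>_. borel :: ((real ^ 2) \<times> (real ^ 2)) measure)"
  let ?K = "kalman_gain g Q R (P (Suc n))"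
  define F' where "F' f = F (restrict f {0..n}) + fst (f (Suc n))" for f
  define E' where "E' f = E (restrict f {0..n}) +
    ?K *v (Z (Suc n) (F' f) - g *\<^sub>R E (restrict f {0..n}))" for f
  have past: "(\<lambda>f. restrict f {0..n}) \<in> measurable ?B (Pi\<^sub>M {0..n} (\<lambda>_. borel))"
    by (rule measurable_restrict_subset) auto
  have new: "(\<lambda>f. fst (f (Suc n))) \<in> borel_measurable ?B"
    by (rule measurable_compose[OF measurable_component_singleton])
      (auto intro!: borel_measurable_continuous_onI continuous_intros)
  note [measurable] = measurable_compose[OF past F] measurable_compose[OF past E] new
  have F' [measurable]: "F' \<in> borel_measurable ?B"
    unfolding F'_def by measurable
  have [measurable]: "(\<lambda>f. Z (Suc n) (F' f)) \<in> borel_measurable ?B"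
    using Suc.prems by (intro measurable_compose[OF F' Z]) simp
  have [measurable]: "(\<lambda>y. ?K *v y) \<in> borel_measurable borel"
    by (intro borel_measurable_continuous_onI linear_continuous_on) simp
  have E': "E' \<in> borel_measurable ?B"
    unfolding E'_def by measurable
  have restr: "restrict (\<lambda>j\<in>{0..Suc n}. Y j x) {0..n} = (\<lambda>j\<in>{0..n}. Y j x)" for x
    by (auto simp: fun_eq_iff restrict_def)
  have "d (Suc n) x = F' (\<lambda>j\<in>{0..Suc n}. Y j x)" if "x \<in> space M" for x
    using walk Suc.prems FE(1)[OF that] that
    unfolding F'_def restr by (simp add: random_walk_def Y_def)
  moreover have "dhat (Suc n) x = dhat n x + ?K *v (zt (Suc n) x - g *\<^sub>R dhat n x)"
    if "x \<in> space M" for x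
    using filter Suc.prems that unfolding kalman_filter_def
    by (metis atLeastAtMost_iff diff_Suc_1 le_add1 plus_1_eq_Suc)
  ultimately have "d (Suc n) x = F' (\<lambda>j\<in>{0..Suc n}. Y j x) \<and> dhat (Suc n) x = E' (\<lambda>j\<in>{0..Suc n}. Y j x)"
    if "x \<in> space M" for x
    using zt[of "Suc n" x] Suc.prems FE(2)[OF that] that unfolding E'_def restr by simp
  with F' E' show ?case by blast
qed

lemma (in prob_space) random_walk_increment_indep:
  assumes walk: "random_walk M Ns Q d0 d q" and k: "k < Ns"
    and F: "F \<in> borel_measurable (Pi\<^sub>M {0..k} (\<lambda>_. borel))"
  defines "Y \<equiv> case_nat (\<lambda>x. (d 0 x, d0 x)) (\<lambda>k x. (q k x, 0))"
  shows "indep_var borel (\<lambda>x. F (\<lambda>j\<in>{0..k}. Y j x)) borel (q k)"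
proof -
  have ind: "indep_vars (\<lambda>_. borel) Y {0..Ns}"
    using walk by (simp add: random_walk_def Y_def)
  have pair: "indep_var (Pi\<^sub>M {0..k} (\<lambda>_. borel)) (\<lambda>x. restrict (\<lambda>j. Y j x) {0..k})
      (Pi\<^sub>M {Suc k} (\<lambda>_. borel)) (\<lambda>x. restrict (\<lambda>j. Y j x) {Suc k})"
    using k by (intro indep_var_restrict[OF ind]) auto
  have "(\<lambda>f. fst (f (Suc k))) \<in> borel_measurable
      (Pi\<^sub>M {Suc k} (\<lambda>_. borel :: ((real ^ 2) \<times> (real ^ 2)) measure))"
    by (rule measurable_compose[OF measurable_component_singleton])
      (auto intro!: borel_measurable_continuous_onI continuous_intros)
  from indep_var_compose[OF pair F this] show ?thesis
    by (simp add: comp_def Y_def)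
qed

lemma kalman_mean_square_error:
  fixes d dhat :: "nat \<Rightarrow> 'a \<Rightarrow> real ^ 2"
  assumes M: "prob_space M" and \<sigma>: "\<sigma> > 0" and c: "c > 0" and g: "g \<noteq> 0"
    and walk: "random_walk M Ns (Finite_Cartesian_Product.mat \<sigma>) (dhat 0) d q"
    and filter: "kalman_filter M Ns g (Finite_Cartesian_Product.mat \<sigma>)
      (Finite_Cartesian_Product.mat c) zt P dhat"
    and d: "square_integrable M (d 0)" and dhat: "square_integrable M (dhat 0)"
    and L: "\<And>k. bounded_linear (L k)"
    and zt: "\<And>k x. k \<in> {1..Ns} \<Longrightarrow> x \<in> space M \<Longrightarrow> zt k x = b k + L k (d k x)"
    and k: "k \<in> {1..Ns}"
  shows "(LINT x|M. (norm (dhat k x - d k x))\<^sup>2) \<le> c / (c + g\<^sup>2 * \<sigma>) *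
      ((LINT x|M. (norm (dhat (k - 1) x - d (k - 1) x))\<^sup>2) + (LINT x|M. (norm (d k x - d (k - 1) x))\<^sup>2)) +
      (LINT x|M. (norm (zt k x - g *\<^sub>R d k x))\<^sup>2) / g\<^sup>2"
proof -
  interpret prob_space M by (rule M)
  have sq_d: "square_integrable M (d n)" if "n \<le> Ns" for n
    using random_walk_square_integrable[OF \<sigma> walk d that] .
  have sq_zt: "square_integrable M (zt n)" if "n \<in> {1..Ns}" for n
  proof -
    have "square_integrable M (\<lambda>x. b n + L n (d n x))"
      using that
      by (intro square_integrable_add square_integrable_const square_integrable_bounded_linear[OF L] sq_d)
        auto
    then show ?thesis
      using zt[OF that] by (subst square_integrable_cong) auto
  qed
  define K where "K n = kalman_gain g (Finite_Cartesian_Product.mat \<sigma>)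
    (Finite_Cartesian_Product.mat c) (P n)" for n
  have step: "dhat n x = dhat (n - 1) x + K n *v (zt n x - g *\<^sub>R dhat (n - 1) x)"
    if "n \<in> {1..Ns}" "x \<in> space M" for n x
    using filter that unfolding kalman_filter_def K_def by blast
  have sq_dhat: "square_integrable M (dhat n)" if "n \<le> Ns" for n
    using that
  proof (induction n)
    case (Suc n)
    then have IH: "square_integrable M (dhat n)" and n: "Suc n \<in> {1..Ns}" by auto
    have "square_integrable M (\<lambda>x. dhat n x + K (Suc n) *v (zt (Suc n) x - g *\<^sub>R dhat n x))"
      by (intro square_integrable_add square_integrable_diff IH sq_zt[OF n]
          square_integrable_bounded_linear[OF matrix_vector_mul_bounded_linear]
          square_integrable_bounded_linear[OF bounded_linear_scaleR_right])
    then show ?case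
      using step[OF n] by (subst square_integrable_cong) auto
  qed (use dhat in simp)
  obtain m where m: "k = Suc m" "m < Ns" using k by (cases k) auto
  define X where "X x = dhat m x - d m x" for x
  define \<eta> where "\<eta> x = zt k x - g *\<^sub>R d k x" for x
  have sq_X: "square_integrable M X"
    unfolding X_def using m by (intro square_integrable_diff sq_dhat sq_d) auto
  have sq_\<eta>: "square_integrable M \<eta>"
    unfolding \<eta>_def using m k
    by (intro square_integrable_diff sq_zt sq_d square_integrable_bounded_linear[OF bounded_linear_scaleR_right]) auto
  have gauss: "distributed M lborel (q m)
      (\<lambda>y. ennreal (gaussian_density 0 (Finite_Cartesian_Product.mat \<sigma>) y))"
    using walk m by (simp add: random_walk_def)
  note sq_q = gaussian_square_integrable[OF \<sigma> gauss]
  have dk: "d k x = d m x + q m x" if "x \<in> space M" for x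
    using walk m that by (simp add: random_walk_def)
  have "(\<lambda>y. b n + L n y) \<in> borel_measurable borel" for n
    by (intro borel_measurable_continuous_onI continuous_intros linear_continuous_on[OF L])
  with kalman_filter_adapted[OF walk refl filter zt _ less_imp_le[OF m(2)]]
  obtain F E where F: "F \<in> borel_measurable (Pi\<^sub>M {0..m} (\<lambda>_. borel))"
    and E: "E \<in> borel_measurable (Pi\<^sub>M {0..m} (\<lambda>_. borel))"
    and FE: "\<And>x. x \<in> space M \<Longrightarrow>
        X x = E (\<lambda>j\<in>{0..m}. case_nat (\<lambda>x. (d 0 x, dhat 0 x)) (\<lambda>k x. (q k x, 0)) j x)
          - F (\<lambda>j\<in>{0..m}. case_nat (\<lambda>x. (d 0 x, dhat 0 x)) (\<lambda>k x. (q k x, 0)) j x)"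
    unfolding X_def by fastforce
  let ?X = "\<lambda>x. E (\<lambda>j\<in>{0..m}. case_nat (\<lambda>x. (d 0 x, dhat 0 x)) (\<lambda>k x. (q k x, 0)) j x)
          - F (\<lambda>j\<in>{0..m}. case_nat (\<lambda>x. (d 0 x, dhat 0 x)) (\<lambda>k x. (q k x, 0)) j x)"
  have sq_X': "square_integrable M ?X"
    using sq_X FE by (subst square_integrable_cong[symmetric]) auto
  have "indep_var borel ?X borel (q m)"
    using random_walk_increment_indep[OF walk m(2) borel_measurable_diff[OF E F]] .
  then have "(LINT x|M. ?X x \<bullet> q m x) = 0"
    using indep_var_integral_inner[of ?X "q m"] gaussian_integral_zero[OF \<sigma> gauss]
      integrable_square_integrable[OF sq_X'] integrable_square_integrable[OF sq_q] by simp
  also have "(LINT x|M. ?X x \<bullet> q m x) = (LINT x|M. X x \<bullet> q m x)"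
    using FE by (intro Bochner_Integration.integral_cong) auto
  finally have orth: "(LINT x|M. X x \<bullet> q m x) = 0" .
  let ?a = "c / (c + g\<^sup>2 * \<sigma>)"
  have pointwise: "(norm (dhat k x - d k x))\<^sup>2 \<le> ?a * (norm (X x - q m x))\<^sup>2 + (norm (\<eta> x))\<^sup>2 / g\<^sup>2"
    if x: "x \<in> space M" for x
  proof -
    have "dhat k x - d k x = (X x - q m x) - g *\<^sub>R (K k *v (X x - q m x)) + K k *v \<eta> x"
      using step[OF k x] dk[OF x] m(1)
      by (simp add: X_def \<eta>_def matrix_vector_mult_diff_distrib matrix_vector_right_distrib
          matrix_vector_mult_scaleR algebra_simps)
    moreover have "posdef (P k)"
      using filter k by (simp add: kalman_filter_def)
    ultimately show ?thesis
      using kalman_update_contraction[OF _ \<sigma> c g] unfolding K_def by simp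
  qed
  have int: "integrable M (\<lambda>x. (norm (X x))\<^sup>2)" "integrable M (\<lambda>x. (norm (q m x))\<^sup>2)"
    "integrable M (\<lambda>x. X x \<bullet> q m x)" "integrable M (\<lambda>x. (norm (\<eta> x))\<^sup>2)"
    "integrable M (\<lambda>x. (norm (X x - q m x))\<^sup>2)"
    using sq_X sq_q sq_\<eta> integrable_inner_square_integrable[OF sq_X sq_q]
      square_integrable_diff[OF sq_X sq_q] by (auto simp: square_integrable_def)
  have "(LINT x|M. (norm (dhat k x - d k x))\<^sup>2)
      \<le> (LINT x|M. ?a * (norm (X x - q m x))\<^sup>2 + (norm (\<eta> x))\<^sup>2 / g\<^sup>2)"
  proof (rule integral_mono)
    show "integrable M (\<lambda>x. (norm (dhat k x - d k x))\<^sup>2)"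
      using square_integrable_diff[OF sq_dhat sq_d, of k k] k by (simp add: square_integrable_def)
  qed (use int pointwise in auto)
  also have "\<dots> = ?a * (LINT x|M. (norm (X x - q m x))\<^sup>2) + (LINT x|M. (norm (\<eta> x))\<^sup>2) / g\<^sup>2"
    using int by simp
  also have "(LINT x|M. (norm (X x - q m x))\<^sup>2)
      = (LINT x|M. (norm (X x))\<^sup>2 - 2 * (X x \<bullet> q m x) + (norm (q m x))\<^sup>2)"
    by (simp add: power2_norm_eq_inner inner_simps inner_commute algebra_simps)
  also have "\<dots> = (LINT x|M. (norm (X x))\<^sup>2) + (LINT x|M. (norm (q m x))\<^sup>2)"
    using int orth by simp
  also have "(LINT x|M. (norm (q m x))\<^sup>2) = (LINT x|M. (norm (d k x - d m x))\<^sup>2)"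
    using dk by (intro Bochner_Integration.integral_cong) auto
  finally show ?thesis
    by (simp add: X_def \<eta>_def m(1))
qed

section \<open>The residuals as measurements\<close>

lemma norm_vec2: "(norm (y :: real ^ 2))\<^sup>2 = (y $ 1)\<^sup>2 + (y $ 2)\<^sup>2"
  by (simp add: norm_vec_def L2_set_def sum_2)

lemma norm_re_im: "norm (re_im z) = cmod z"
proof -
  have "(norm (re_im z))\<^sup>2 = (cmod z)\<^sup>2"
    by (simp add: norm_vec2 re_im_def cmod_power2)
  then show ?thesis by simp
qed

lemma bounded_linear_re_im: "bounded_linear re_im"
  by (rule bounded_linear_intro[where K = 1])
    (auto simp: norm_re_im, auto simp: re_im_def vec_eq_iff forall_2)

lemma bounded_linear_Complex_vec2: "bounded_linear (\<lambda>y :: real ^ 2. Complex (y $ 1) (y $ 2))"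
proof (rule bounded_linear_intro[where K = 1])
  show "norm (Complex (y $ 1) (y $ 2)) \<le> norm y * 1" for y :: "real ^ 2"
    using norm_vec2[of y] by (simp add: cmod_def real_sqrt_le_iff real_le_lsqrt)
qed (auto simp: complex_eq_iff)

lemma Complex_re_im: "Complex (re_im z $ 1) (re_im z $ 2) = z"
  by (simp add: re_im_def)

text \<open>
  The residual is the ideal measurement of \<open>re_im z\<close> plus a noise that is linear in the
  parameter error, because \<open>z\<^sub>i = H\<^sub>i \<theta>\<^sub>i - [\<theta>\<^sub>i]\<^sub>2 d\<^sub>i\<close> holds with the true parameters.
\<close>

lemma residual_error:
  fixes \<theta>hat :: "real ^ 2" and \<gamma> \<rho> \<omega> :: real and z :: complex
  assumes \<rho>: "\<rho> > 0"
  defines "h \<equiv> equiv_admittance \<gamma> \<rho> (\<i> * complex_of_real \<omega>) * (1 - z)"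
  shows "meas_mat h *v \<theta>hat - meas_vec \<omega> h = (\<theta>hat $ 2) *\<^sub>R re_im z +
    re_im (of_real (\<theta>hat $ 2 - \<gamma>) * (1 - z) - of_real (\<theta>hat $ 1 - \<rho>) * h)"
proof -
  have "Re (\<i> * complex_of_real \<omega> + \<i> + complex_of_real \<rho>) \<noteq> 0"
    using \<rho> by simp
  then have "\<i> * complex_of_real \<omega> + \<i> + complex_of_real \<rho> \<noteq> 0"
    by force
  then have "h * (\<i> * complex_of_real \<omega> + \<i> + complex_of_real \<rho>) = of_real \<gamma> * (1 - z)"
    by (simp add: h_def equiv_admittance_def)
  then have "\<rho> * Re h - (\<omega> + 1) * Im h = \<gamma> * (1 - Re z)" "\<rho> * Im h + (\<omega> + 1) * Re h = - \<gamma> * Im z"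
    by (simp_all add: complex_eq_iff algebra_simps)
  then show ?thesis
    by (simp add: vec_eq_iff forall_2 matrix_vector_mult_def sum_2 meas_mat_def meas_vec_def re_im_def
        algebra_simps)
qed

lemma residual_error_bound:
  fixes e :: "real ^ 2"
  shows "(cmod (of_real (e $ 2) * (1 - z) - of_real (e $ 1) * h))\<^sup>2
    \<le> 2 * (norm e)\<^sup>2 * (1 + (cmod h)\<^sup>2 + (cmod z)\<^sup>2)"
proof -
  have "(cmod (of_real (e $ 2) * (1 - z) - of_real (e $ 1) * h))\<^sup>2
      \<le> (\<bar>e $ 2\<bar> * cmod (1 - z) + \<bar>e $ 1\<bar> * cmod h)\<^sup>2"
    using norm_triangle_ineq4[of "of_real (e $ 2) * (1 - z)" "of_real (e $ 1) * h"]
    by (intro power_mono) (auto simp: norm_mult)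
  also have "\<dots> \<le> ((e $ 1)\<^sup>2 + (e $ 2)\<^sup>2) * ((cmod (1 - z))\<^sup>2 + (cmod h)\<^sup>2)"
    using zero_le_power2[of "\<bar>e $ 1\<bar> * cmod (1 - z) - \<bar>e $ 2\<bar> * cmod h"]
    by (simp add: power2_eq_square algebra_simps)
  also have "\<dots> \<le> ((e $ 1)\<^sup>2 + (e $ 2)\<^sup>2) * (2 * (1 + (cmod h)\<^sup>2 + (cmod z)\<^sup>2))"
  proof (intro mult_left_mono)
    have "(cmod (1 - z))\<^sup>2 + (cmod (1 + z))\<^sup>2 = 2 + 2 * (cmod z)\<^sup>2"
      unfolding cmod_power2 by (simp add: power2_eq_square algebra_simps)
    then have "(cmod (1 - z))\<^sup>2 \<le> 2 + 2 * (cmod z)\<^sup>2"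
      using zero_le_power2[of "cmod (1 + z)"] by linarith
    then show "(cmod (1 - z))\<^sup>2 + (cmod h)\<^sup>2 \<le> 2 * (1 + (cmod h)\<^sup>2 + (cmod z)\<^sup>2)"
      by (simp add: add_increasing)
  qed simp
  finally show ?thesis unfolding norm_vec2 by (simp only: mult_ac)
qed

theorem theorem2:
  fixes N i Ns :: nat
    and line :: "nat \<Rightarrow> nat \<Rightarrow> bool"
    and r l :: "nat \<Rightarrow> nat \<Rightarrow> real" and rf lf :: "nat \<Rightarrow> real"
    and \<rho> \<rho>f fs \<sigma>\<^sub>q c\<^sub>1 :: real
    and M :: "'a measure"
    and u :: "nat \<Rightarrow> nat \<Rightarrow> 'a \<Rightarrow> complex" and v :: "nat \<Rightarrow> complex"
    and exc :: "nat \<Rightarrow> 'a \<Rightarrow> complex" and G Gt :: "complex \<Rightarrow> complex"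
    and q dhat :: "nat \<Rightarrow> 'a \<Rightarrow> real ^ 2"
    and P :: "nat \<Rightarrow> real ^ 2 ^ 2"
    and \<theta>hat :: "real ^ 2"
  defines "\<Gamma> \<equiv> laplacian N line l"
  defines "\<gamma> \<equiv> equiv_susceptance N \<Gamma> lf i"
  defines "s \<equiv> jfreq fs Ns"
  defines "vt \<equiv> \<lambda>k x. equiv_voltage N \<Gamma> lf i (\<lambda>j. u j k x)"
  defines "cur \<equiv> \<lambda>k x. equiv_admittance \<gamma> \<rho> (s k) * (v k - vt k x)"
  defines "h \<equiv> \<lambda>k x. cur k x / v k"
  defines "ht \<equiv> \<lambda>k x. vt k x / v k"
  defines "d \<equiv> \<lambda>k x. re_im (ht k x)"
  defines "\<theta> \<equiv> vector [\<rho>, \<gamma>] :: real ^ 2"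
  defines "\<epsilon>\<theta> \<equiv> \<theta>hat - \<theta>"
  defines "h' \<equiv> ratio_estimate M exc cur (\<lambda>k x. v k)"
  defines "S \<equiv> sqrt (data_mean Ns (\<lambda>k. (cmod (Gt (s k) / G (s k)))\<^sup>2))"
  defines "\<epsilon>d \<equiv> \<lambda>k x. dhat k x - d k x"
  defines "\<Delta>d \<equiv> \<lambda>k x. d k x - d (k - 1) x"
  defines "vhat \<equiv> \<lambda>k x. v k * Complex (dhat k x $ 1) (dhat k x $ 2)"
  defines "ev\<^sub>i \<equiv> \<lambda>k x. vhat k x - vt k x"
  defines "Q \<equiv> Finite_Cartesian_Product.mat \<sigma>\<^sub>q :: real ^ 2 ^ 2"
  defines "R \<equiv> Finite_Cartesian_Product.mat c\<^sub>1 :: real ^ 2 ^ 2"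
  defines "zt \<equiv> \<lambda>k x. meas_mat (h k x) *v \<theta>hat - meas_vec (freq fs Ns k) (h k x)"
  defines "bound \<equiv> \<lambda>\<phi> k.
      \<phi>\<^sup>2 * ((LINT x|M. (norm (\<epsilon>d (k - 1) x))\<^sup>2) + (LINT x|M. (norm (\<Delta>d k x))\<^sup>2)) +
      2 * (norm \<epsilon>\<theta>)\<^sup>2 / (\<theta>hat $ 2)\<^sup>2 *
        (1 + (LINT x|M. (cmod (h k x))\<^sup>2) + (LINT x|M. (norm (d k x))\<^sup>2))"
  assumes "i < N" and "fs > 0" and "Ns \<ge> 1"
    and "homogeneous_lines N line r l \<rho>" and "0 < \<rho>" and "\<rho> < 1"
    and "homogeneous_filters N rf lf \<rho>f" and "0 < \<rho>f" and "\<rho>f < 1"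
    and "prob_space M"
    and "\<And>j k. j < N \<Longrightarrow> j \<noteq> i \<Longrightarrow> k \<le> Ns \<Longrightarrow> u j k \<in> borel_measurable M"
    and "\<gamma> \<noteq> 0" and "\<And>k. k \<le> Ns \<Longrightarrow> v k \<noteq> 0"
    and "\<And>k. k \<le> Ns \<Longrightarrow> exc k \<in> borel_measurable M"
    and "\<And>k. k \<le> Ns \<Longrightarrow> integrable M (\<lambda>x. (cmod (exc k x))\<^sup>2)"
    and "\<And>k. k \<le> Ns \<Longrightarrow> (LINT x|M. cnj (exc k x) * v k) \<noteq> 0"
    and "transfer_function M s Ns exc (\<lambda>k x. v k) G"
    and "transfer_function M s Ns exc vt Gt"
    and "\<And>k. k \<le> Ns \<Longrightarrow> G (s k) \<noteq> 0"
    and "data_var Ns (\<lambda>k. Re (h' k)) + data_mean Ns (\<lambda>k. (Im (h' k))\<^sup>2) \<noteq> 0"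
    and "norm \<epsilon>\<theta> < \<gamma> * S * sqrt ((1 + data_mean Ns (\<lambda>k. (cmod (h' k))\<^sup>2)) /
           (data_var Ns (\<lambda>k. Re (h' k)) + data_mean Ns (\<lambda>k. (Im (h' k))\<^sup>2)))"
    and "\<theta>hat $ 2 \<noteq> 0"
    and "\<sigma>\<^sub>q > 0" and "c\<^sub>1 > 0"
    and "integrable M (\<lambda>x. (norm (d 0 x))\<^sup>2)"
    and "dhat 0 \<in> borel_measurable M" and "integrable M (\<lambda>x. (norm (dhat 0 x))\<^sup>2)"
    and "random_walk M Ns Q (dhat 0) d q"
    and "kalman_filter M Ns (\<theta>hat $ 2) Q R zt P dhat"
  shows "\<exists>\<phi>. 0 < \<phi> \<and> \<phi> < 1 \<and>
    (\<forall>k\<in>{1..Ns}. (LINT x|M. (norm (\<epsilon>d k x))\<^sup>2) \<le> bound \<phi> k) \<and>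
    (\<forall>k\<in>{0..Ns}. (LINT x|M. (cmod (ev\<^sub>i k x))\<^sup>2) = (cmod (v k))\<^sup>2 * (LINT x|M. (norm (\<epsilon>d k x))\<^sup>2)) \<and>
    (\<forall>k\<in>{1..Ns}. (LINT x|M. (cmod (ev\<^sub>i k x))\<^sup>2) \<le> (cmod (v k))\<^sup>2 * bound \<phi> k)"
proof -
  interpret prob_space M by fact
  note v0 = \<open>\<And>k. k \<le> Ns \<Longrightarrow> v k \<noteq> 0\<close>
  let ?g = "\<theta>hat $ 2"
  define Y where "Y k = equiv_admittance \<gamma> \<rho> (s k)" for k
  define \<kappa> where "\<kappa> k = of_real (\<epsilon>\<theta> $ 2) - of_real (\<epsilon>\<theta> $ 1) * Y k" for k
  define L where "L k y = ?g *\<^sub>R y - re_im (\<kappa> k * Complex (y $ 1) (y $ 2))" for k y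
  define b where "b k = re_im (\<kappa> k)" for k
  define \<phi> where "\<phi> = sqrt (c\<^sub>1 / (c\<^sub>1 + ?g\<^sup>2 * \<sigma>\<^sub>q))"
  have gain: "0 < ?g\<^sup>2 * \<sigma>\<^sub>q" using assms by simp
  have h: "h k x = Y k * (1 - ht k x)" if "k \<le> Ns" for k x
    using v0[OF that] by (simp add: h_def cur_def Y_def ht_def field_simps)
  have \<epsilon>: "\<epsilon>\<theta> $ 1 = \<theta>hat $ 1 - \<rho>" "\<epsilon>\<theta> $ 2 = ?g - \<gamma>"
    by (simp_all add: \<epsilon>\<theta>_def \<theta>_def)
  have residual: "zt k x = ?g *\<^sub>R d k x +
      re_im (of_real (\<epsilon>\<theta> $ 2) * (1 - ht k x) - of_real (\<epsilon>\<theta> $ 1) * h k x)" if "k \<le> Ns" for k x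
    using residual_error[OF \<open>0 < \<rho>\<close>, of \<gamma> "freq fs Ns k" "ht k x" \<theta>hat]
    by (simp add: zt_def h[OF that] Y_def s_def jfreq_def d_def \<epsilon>)
  have L: "bounded_linear (L k)" for k
    unfolding L_def
    by (intro bounded_linear_sub bounded_linear_scaleR_right
        bounded_linear_compose[OF bounded_linear_re_im]
        bounded_linear_compose[OF bounded_linear_mult_right] bounded_linear_Complex_vec2)
  have zt: "zt k x = b k + L k (d k x)" if "k \<le> Ns" for k x
  proof -
    have "re_im (\<kappa> k * (1 - ht k x)) = re_im (\<kappa> k) - re_im (\<kappa> k * ht k x)"
      by (simp add: right_diff_distrib linear_diff[OF bounded_linear.linear[OF bounded_linear_re_im]])
    moreover have "of_real (\<epsilon>\<theta> $ 2) * (1 - ht k x) - of_real (\<epsilon>\<theta> $ 1) * h k x = \<kappa> k * (1 - ht k x)"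
      unfolding h[OF that] \<kappa>_def by (simp add: algebra_simps)
    ultimately show ?thesis
      unfolding residual[OF that] by (simp add: b_def L_def d_def Complex_re_im)
  qed
  have sq_d0: "square_integrable M (d 0)"
  proof -
    let ?Y = "case_nat (\<lambda>x. (d 0 x, dhat 0 x)) (\<lambda>k x. (q k x, 0))"
    have "indep_vars (\<lambda>_. borel) ?Y {0..Ns}"
      using \<open>random_walk M Ns Q (dhat 0) d q\<close> unfolding random_walk_def by (elim conjE)
    then have "\<forall>j\<in>{0..Ns}. ?Y j \<in> borel_measurable M"
      unfolding indep_vars_def by (elim conjE)
    from bspec[OF this, of 0] have "(\<lambda>x. (d 0 x, dhat 0 x)) \<in> borel_measurable M"
      by simp
    then have "(\<lambda>x. fst (d 0 x, dhat 0 x)) \<in> borel_measurable M"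
      by (rule measurable_compose) (auto intro!: borel_measurable_continuous_onI continuous_intros)
    then show ?thesis
      using \<open>integrable M (\<lambda>x. (norm (d 0 x))\<^sup>2)\<close> by (simp add: square_integrable_def)
  qed
  have sq_dhat0: "square_integrable M (dhat 0)"
    using assms by (simp add: square_integrable_def)
  have walk: "random_walk M Ns (Finite_Cartesian_Product.mat \<sigma>\<^sub>q) (dhat 0) d q"
    using \<open>random_walk M Ns Q (dhat 0) d q\<close> unfolding Q_def .
  have sq_d: "square_integrable M (d k)" if "k \<le> Ns" for k
    using random_walk_square_integrable[OF \<open>\<sigma>\<^sub>q > 0\<close> walk sq_d0 that] .
  have norm_d: "norm (d k x) = cmod (ht k x)" for k x
    by (simp add: d_def norm_re_im)
  have int_h: "integrable M (\<lambda>x. (cmod (h k x))\<^sup>2)" if "k \<le> Ns" for k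
  proof -
    have "square_integrable M (\<lambda>x. Complex (d k x $ 1) (d k x $ 2))"
      by (rule square_integrable_bounded_linear[OF bounded_linear_Complex_vec2 sq_d[OF that]])
    then have "square_integrable M (ht k)"
      by (simp add: d_def Complex_re_im)
    then have "square_integrable M (\<lambda>x. Y k * (1 - ht k x))"
      by (intro square_integrable_bounded_linear[OF bounded_linear_mult_right]
          square_integrable_diff square_integrable_const)
    then show ?thesis
      by (simp add: h[OF that] square_integrable_def)
  qed
  have noise: "(LINT x|M. (norm (zt k x - ?g *\<^sub>R d k x))\<^sup>2) \<le> 2 * (norm \<epsilon>\<theta>)\<^sup>2 *
      (1 + (LINT x|M. (cmod (h k x))\<^sup>2) + (LINT x|M. (norm (d k x))\<^sup>2))" if "k \<le> Ns" for k
  proof -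
    have int_d: "integrable M (\<lambda>x. (norm (d k x))\<^sup>2)"
      using sq_d[OF that] by (simp add: square_integrable_def)
    have "square_integrable M (\<lambda>x. b k + L k (d k x) - ?g *\<^sub>R d k x)"
      by (intro square_integrable_diff square_integrable_add square_integrable_const
          square_integrable_bounded_linear[OF L]
          square_integrable_bounded_linear[OF bounded_linear_scaleR_right] sq_d[OF that])
    then have "integrable M (\<lambda>x. (norm (zt k x - ?g *\<^sub>R d k x))\<^sup>2)"
      by (simp add: zt[OF that] square_integrable_def)
    then have "(LINT x|M. (norm (zt k x - ?g *\<^sub>R d k x))\<^sup>2)
        \<le> (LINT x|M. 2 * (norm \<epsilon>\<theta>)\<^sup>2 * (1 + (cmod (h k x))\<^sup>2 + (norm (d k x))\<^sup>2))"
      using int_d int_h[OF that] residual_error_bound[of \<epsilon>\<theta>]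
      by (intro integral_mono) (auto simp: residual[OF that] norm_re_im norm_d)
    also have "\<dots> = 2 * (norm \<epsilon>\<theta>)\<^sup>2 *
        (1 + (LINT x|M. (cmod (h k x))\<^sup>2) + (LINT x|M. (norm (d k x))\<^sup>2))"
      using int_d int_h[OF that] by (simp add: prob_space)
    finally show ?thesis .
  qed
  have "0 < \<phi>" "\<phi> < 1"
    using \<open>c\<^sub>1 > 0\<close> gain by (simp_all add: \<phi>_def)
  moreover have mse: "(LINT x|M. (norm (\<epsilon>d k x))\<^sup>2) \<le> bound \<phi> k" if k: "k \<in> {1..Ns}" for k
  proof -
    have \<phi>2: "\<phi>\<^sup>2 = c\<^sub>1 / (c\<^sub>1 + ?g\<^sup>2 * \<sigma>\<^sub>q)"
      using \<open>c\<^sub>1 > 0\<close> gain by (simp add: \<phi>_def)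
    have "(LINT x|M. (norm (\<epsilon>d k x))\<^sup>2)
        \<le> \<phi>\<^sup>2 * ((LINT x|M. (norm (\<epsilon>d (k - 1) x))\<^sup>2) + (LINT x|M. (norm (\<Delta>d k x))\<^sup>2)) +
          (LINT x|M. (norm (zt k x - ?g *\<^sub>R d k x))\<^sup>2) / ?g\<^sup>2"
      unfolding \<phi>2 \<epsilon>d_def \<Delta>d_def
    proof (rule kalman_mean_square_error[where d = d and dhat = dhat and b = b and L = L
          and g = ?g and \<sigma> = \<sigma>\<^sub>q and c = c\<^sub>1 and zt = zt and P = P and q = q and Ns = Ns])
      show "kalman_filter M Ns ?g (Finite_Cartesian_Product.mat \<sigma>\<^sub>q)
          (Finite_Cartesian_Product.mat c\<^sub>1) zt P dhat"
        using \<open>kalman_filter M Ns ?g Q R zt P dhat\<close> unfolding Q_def R_def .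
      show "zt k x = b k + L k (d k x)" if "k \<in> {1..Ns}" for k x
        using zt that by simp
    qed (fact \<open>prob_space M\<close> \<open>\<sigma>\<^sub>q > 0\<close> \<open>c\<^sub>1 > 0\<close> \<open>?g \<noteq> 0\<close> walk sq_d0 sq_dhat0 L k)+
    also have "(LINT x|M. (norm (zt k x - ?g *\<^sub>R d k x))\<^sup>2) / ?g\<^sup>2 \<le> 2 * (norm \<epsilon>\<theta>)\<^sup>2 *
        (1 + (LINT x|M. (cmod (h k x))\<^sup>2) + (LINT x|M. (norm (d k x))\<^sup>2)) / ?g\<^sup>2"
      using noise[of k] k by (intro divide_right_mono) auto
    finally show ?thesis
      by (simp add: bound_def)
  qed
  moreover have volt: "(LINT x|M. (cmod (ev\<^sub>i k x))\<^sup>2) = (cmod (v k))\<^sup>2 * (LINT x|M. (norm (\<epsilon>d k x))\<^sup>2)"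
    if k: "k \<le> Ns" for k
  proof -
    have "ev\<^sub>i k x = v k * Complex (\<epsilon>d k x $ 1) (\<epsilon>d k x $ 2)" for x
    proof -
      have "vt k x = v k * ht k x"
        using v0[OF k] by (simp add: ht_def)
      moreover have "Complex (\<epsilon>d k x $ 1) (\<epsilon>d k x $ 2) = Complex (dhat k x $ 1) (dhat k x $ 2) - ht k x"
        by (simp add: \<epsilon>d_def d_def re_im_def complex_eq_iff)
      ultimately show ?thesis
        by (simp add: ev\<^sub>i_def vhat_def right_diff_distrib)
    qed
    then have "(cmod (ev\<^sub>i k x))\<^sup>2 = (cmod (v k))\<^sup>2 * (norm (\<epsilon>d k x))\<^sup>2" for x
      by (simp add: norm_mult power_mult_distrib norm_vec2 cmod_power2)
    then show ?thesis by simp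
  qed
  ultimately show ?thesis
    by (intro exI[of _ \<phi>]) (simp add: mult_left_mono)
qed

end
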